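(* Let $d=d_X+d_Z$, $0<\beta\le 1$ and $0<\gamma\le 1$. Suppose $g(x,z):[0,1]^d\to[-M,M]$ is a bounded function such that, for some constant $C$ and all $(x,z),(x',z')\in[0,1]^d$, $$|g(x,z)-g(x',z')|\le C\,(\|x-x'\|_1^{\beta}+\|z-z'\|_1^{\gamma}).$$ If $p_{X|Z}(x|z)=\frac{\exp(g(x,z))}{\int\exp(g(x,z))\,dx}$, then $p_{X,Z}\in\mathcal{P}_{\beta,\gamma}$.
   Context: $x\in[0,1]^{d_X}$, $z\in[0,1]^{d_Z}$; the integral in $x$ is over $[0,1]^{d_X}$; $p_{X,Z}=p_{X|Z}\,p_Z$ with any marginal density $p_Z$ on $[0,1]^{d_Z}$. The class $\mathcal{P}_{\beta,\gamma}$ (for $\beta>0$, $0<\gamma\le1$): $p_{X,Z}\in\mathcal{P}_{\beta,\gamma}$ if, for some constants $W_1,W_2>0$ ($W_2$ sufficiently large; the values of the constants are not tracked in the membership asserted), with $\ell=\lfloor\beta\rfloor$ the greatest integer strictly less than $\beta$: (Hölder smoothness in $x$) $p_{X|Z}(x|z)$ is $\ell$ times differentiable in $x$ and for all $x,x'\in[0,1]^{d_X}$, $z\in[0,1]^{d_Z}$ and $\alpha\in\mathbb{N}_0^{d_X}$ with $\|\alpha\|_1=\ell$: $|D^\alpha p_{X|Z}(x|z)-D^\alpha p_{X|Z}(x'|z)|\le W_1\|x-x'\|_1^{\beta-\ell}$ (for $\beta\le1$, $\ell=0$ and $D^\alpha$ is the identity); ($\gamma$-TV smoothness in $z$) for all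 $z,z'\in[0,1]^{d_Z}$: $\int|p_{X|Z}(x|z)-p_{X|Z}(x|z')|dx\le W_2\|z-z'\|_1^\gamma$. *)

theory Defs
  imports "HOL-Analysis.Analysis"
begin

abbreviation unit_cube :: "(real ^ 'n) set" where
  "unit_cube \<equiv> cbox 0 1"

definition l1_norm :: "real ^ 'n \<Rightarrow> real" where
  "l1_norm x = (\<Sum>i\<in>UNIV. \<bar>x $ i\<bar>)"

definition prob_density_on :: "'a::euclidean_space set \<Rightarrow> ('a \<Rightarrow> real) \<Rightarrow> bool" where
  "prob_density_on S f \<longleftrightarrow>
     set_integrable lborel S f \<and> (\<forall>x\<in>S. 0 \<le> f x) \<and> (LINT x:S|lborel. f x) = 1"

text \<open>
  Derivatives are taken within the set S, hence one-sided at the boundary of the cube. They are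
  unique there, since the cube is convex with non-empty interior.
\<close>

definition partial_deriv ::
    "(real ^ 'n) set \<Rightarrow> 'n \<Rightarrow> (real ^ 'n \<Rightarrow> real) \<Rightarrow> real ^ 'n \<Rightarrow> real" where
  "partial_deriv S i f = (\<lambda>x. frechet_derivative f (at x within S) (axis i 1))"

primrec times_differentiable_on ::
    "nat \<Rightarrow> (real ^ 'n) set \<Rightarrow> (real ^ 'n \<Rightarrow> real) \<Rightarrow> bool" where
  "times_differentiable_on 0 S f \<longleftrightarrow> True"
| "times_differentiable_on (Suc k) S f \<longleftrightarrow>
     f differentiable_on S \<and> (\<forall>i. times_differentiable_on k S (partial_deriv S i f))"

text \<open>
  The index type carries no order, so the list fixes in which order the partial derivatives of a
  multi-index are taken. For a function on the cube that is \<open>\<Sum>i\<in>UNIV. \<alpha> $ i\<close> times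
  differentiable the order is irrelevant by the symmetry of second derivatives.
\<close>

definition multi_deriv ::
    "(real ^ 'n) set \<Rightarrow> nat ^ 'n \<Rightarrow> (real ^ 'n \<Rightarrow> real) \<Rightarrow> real ^ 'n \<Rightarrow> real" where
  "multi_deriv S \<alpha> f =
     foldr (partial_deriv S) (SOME is. \<forall>i. count_list is i = \<alpha> $ i) f"

text \<open>The greatest integer strictly less than \<open>\<beta>\<close>, which is \<open>\<beta> - 1\<close> for integral \<open>\<beta>\<close>.\<close>

definition strict_floor :: "real \<Rightarrow> nat" where
  "strict_floor \<beta> = nat (\<lceil>\<beta>\<rceil> - 1)"

text \<open>Below, \<open>q x z\<close> stands for the conditional density at \<open>x\<close> given \<open>z\<close>.\<close>

definition holder_smooth :: "real \<Rightarrow> real \<Rightarrow> (real ^ 'm \<Rightarrow> real ^ 'n \<Rightarrow> real) \<Rightarrow> bool" where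
  "holder_smooth \<beta> W q \<longleftrightarrow>
     (\<forall>z\<in>unit_cube.
        times_differentiable_on (strict_floor \<beta>) unit_cube (\<lambda>x. q x z) \<and>
        (\<forall>\<alpha>. (\<Sum>i\<in>UNIV. \<alpha> $ i) = strict_floor \<beta> \<longrightarrow>
           (\<forall>x\<in>unit_cube. \<forall>x'\<in>unit_cube.
              \<bar>multi_deriv unit_cube \<alpha> (\<lambda>x. q x z) x - multi_deriv unit_cube \<alpha> (\<lambda>x. q x z) x'\<bar>
                \<le> W * l1_norm (x - x') powr (\<beta> - real (strict_floor \<beta>)))))"

definition tv_smooth :: "real \<Rightarrow> real \<Rightarrow> (real ^ 'm \<Rightarrow> real ^ 'n \<Rightarrow> real) \<Rightarrow> bool" where
  "tv_smooth \<gamma> W q \<longleftrightarrow>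
     (\<forall>z\<in>unit_cube. \<forall>z'\<in>unit_cube.
        (LINT x:unit_cube|lborel. \<bar>q x z - q x z'\<bar>) \<le> W * l1_norm (z - z') powr \<gamma>)"

definition smooth_conditional ::
    "real \<Rightarrow> real \<Rightarrow> (real ^ 'm \<Rightarrow> real ^ 'n \<Rightarrow> real) \<Rightarrow> bool" where
  "smooth_conditional \<beta> \<gamma> q \<longleftrightarrow>
     (\<exists>W1>0. \<exists>W2>0. holder_smooth \<beta> W1 q \<and> tv_smooth \<gamma> W2 q)"

text \<open>
  \<open>q\<close> is a version of the conditional density of \<open>p\<close>, with marginal density \<open>pZ\<close>. Where \<open>pZ\<close>
  vanishes the joint density does not determine \<open>q\<close>, so versions are not unique.
\<close>

definition factorization ::
    "((real ^ 'm) \<times> (real ^ 'n) \<Rightarrow> real) \<Rightarrow> (real ^ 'm \<Rightarrow> real ^ 'n \<Rightarrow> real) \<Rightarrow>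
     (real ^ 'n \<Rightarrow> real) \<Rightarrow> bool" where
  "factorization p q pZ \<longleftrightarrow>
     prob_density_on (unit_cube \<times> unit_cube) p \<and>
     prob_density_on unit_cube pZ \<and>
     (\<forall>z\<in>unit_cube. prob_density_on unit_cube (\<lambda>x. q x z)) \<and>
     (\<forall>x\<in>unit_cube. \<forall>z\<in>unit_cube. p (x, z) = q x z * pZ z)"

definition density_class :: "real \<Rightarrow> real \<Rightarrow> ((real ^ 'm) \<times> (real ^ 'n) \<Rightarrow> real) set" where
  "density_class \<beta> \<gamma> = {p. \<exists>q pZ. factorization p q pZ \<and> smooth_conditional \<beta> \<gamma> q}"

end

theory Submission
  imports Defs
begin

text \<open>
  Write \<open>Z z\<close> for the normalising integral \<open>\<integral> exp (g (y, z)) dy\<close>, so that the conditional density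
  is \<open>q x z = exp (h x z)\<close> with log-density \<open>h x z = g (x, z) - ln (Z z)\<close>.

  Everything follows from the fact that normalisation only doubles the modulus of continuity in
  \<open>z\<close>. If \<open>\<bar>g (y, z) - g (y, z')\<bar> \<le> r\<close> for all \<open>y\<close>, then
  \<open>exp (g (y, z)) \<le> exp r * exp (g (y, z'))\<close>, and integrating over \<open>y\<close> gives
  \<open>Z z \<le> exp r * Z z'\<close>, that is, \<open>ln (Z z) - ln (Z z') \<le> r\<close>. So \<open>h\<close> satisfies the same kind of
  joint Hoelder bound as \<open>g\<close>, with constants \<open>C\<close> in \<open>x\<close> and \<open>2 * C\<close> in \<open>z\<close>
  (\<open>jointly_holder_log_density\<close>). Since the cube has volume one, \<open>ln (Z z) \<ge> -M\<close> and hence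
  \<open>h \<le> 2 * M\<close>; on \<open>{..2 * M}\<close> the exponential is Lipschitz with constant \<open>exp (2 * M)\<close>, so \<open>q\<close>
  is jointly Hoelder as well.

  For \<open>\<beta> \<le> 1\<close> smoothness of order \<open>\<beta>\<close> involves no derivatives, so the bound on \<open>q\<close> at a fixed
  \<open>z\<close> is the smoothness in \<open>x\<close>, while the bound at a fixed \<open>x\<close>, integrated over the cube, is the
  total variation smoothness in \<open>z\<close>. The joint bound also makes \<open>q\<close> continuous, hence measurable
  in both variables together, which is what Tonelli's theorem needs to show that the product with
  the marginal density is a joint density.
\<close>

section \<open>Joint Hoelder bounds\<close>

definition jointly_holder ::
    "real \<Rightarrow> real \<Rightarrow> real \<Rightarrow> real \<Rightarrow> (real ^ 'm \<Rightarrow> real ^ 'n \<Rightarrow> real) \<Rightarrow> bool" where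
  "jointly_holder A \<beta> B \<gamma> f \<longleftrightarrow>
     (\<forall>x\<in>unit_cube. \<forall>x'\<in>unit_cube. \<forall>z\<in>unit_cube. \<forall>z'\<in>unit_cube.
        \<bar>f x z - f x' z'\<bar> \<le> A * l1_norm (x - x') powr \<beta> + B * l1_norm (z - z') powr \<gamma>)"

lemma jointly_holderD:
  assumes "jointly_holder A \<beta> B \<gamma> f"
    and "x \<in> unit_cube" "x' \<in> unit_cube" "z \<in> unit_cube" "z' \<in> unit_cube"
  shows "\<bar>f x z - f x' z'\<bar> \<le> A * l1_norm (x - x') powr \<beta> + B * l1_norm (z - z') powr \<gamma>"
  using assms unfolding jointly_holder_def by blast

lemma l1_norm_nonneg [simp]: "0 \<le> l1_norm x"
  unfolding l1_norm_def by (simp add: sum_nonneg)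

lemma l1_norm_zero [simp]: "l1_norm 0 = 0"
  unfolding l1_norm_def by simp

lemma continuous_on_l1_norm [continuous_intros]:
  "continuous_on S f \<Longrightarrow> continuous_on S (\<lambda>x. l1_norm (f x))"
  unfolding l1_norm_def by (intro continuous_intros)

lemma continuous_on_jointly_holder:
  fixes f :: "real ^ 'm \<Rightarrow> real ^ 'n \<Rightarrow> real"
  assumes holder: "jointly_holder A \<beta> B \<gamma> f" and "0 < \<beta>" "0 < \<gamma>"
  shows "continuous_on (unit_cube \<times> unit_cube) (\<lambda>(x, z). f x z)"
  unfolding continuous_on_def
proof
  let ?S = "(unit_cube :: (real ^ 'm) set) \<times> (unit_cube :: (real ^ 'n) set)"
  fix w assume w: "w \<in> ?S"
  define b where "b = (\<lambda>v. A * l1_norm (fst v - fst w) powr \<beta> + B * l1_norm (snd v - snd w) powr \<gamma>)"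
  have "continuous_on ?S b"
    unfolding b_def using assms(2,3) by (intro continuous_intros continuous_on_powr') auto
  then have "(b \<longlongrightarrow> b w) (at w within ?S)"
    using w unfolding continuous_on_def by blast
  then have b: "(b \<longlongrightarrow> 0) (at w within ?S)"
    using assms(2,3) by (simp add: b_def)
  have "\<forall>\<^sub>F v in at w within ?S.
      norm ((\<lambda>(x, z). f x z) v - (\<lambda>(x, z). f x z) w) \<le> b v"
    unfolding eventually_at_filter b_def
    by (rule always_eventually) (use w in \<open>auto intro!: jointly_holderD[OF holder]\<close>)
  from Lim_null_comparison[OF this b]
  show "((\<lambda>(x, z). f x z) \<longlongrightarrow> (\<lambda>(x, z). f x z) w) (at w within ?S)"
    by (rule LIM_zero_cancel)
qed

lemma continuous_on_section_jointly_holder: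
  assumes "jointly_holder A \<beta> B \<gamma> f" "0 < \<beta>" "0 < \<gamma>" "z \<in> unit_cube"
  shows "continuous_on unit_cube (\<lambda>x. f x z)"
proof -
  have "continuous_on unit_cube (\<lambda>x. (\<lambda>(x, z). f x z) (x, z))"
    by (rule continuous_on_compose2[OF continuous_on_jointly_holder[OF assms(1-3)]])
      (use assms(4) in \<open>auto intro!: continuous_intros\<close>)
  then show ?thesis by simp
qed

text \<open>The Lipschitz bound for the exponential is the tangent inequality \<open>1 + t \<le> exp t\<close>.\<close>

lemma abs_exp_diff_le:
  fixes a b N :: real
  assumes "a \<le> N" "b \<le> N"
  shows "\<bar>exp a - exp b\<bar> \<le> exp N * \<bar>a - b\<bar>"
proof -
  have *: "exp s - exp t \<le> exp N * (s - t)" if "t \<le> s" "s \<le> N" for s t :: real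
  proof -
    have "exp s - exp t = exp s * (1 - exp (t - s))"
      by (simp add: algebra_simps flip: exp_add)
    also have "\<dots> \<le> exp s * (s - t)"
      using exp_ge_add_one_self[of "t - s"] by (intro mult_left_mono) (auto simp: algebra_simps)
    also have "\<dots> \<le> exp N * (s - t)"
      using that by (intro mult_right_mono) auto
    finally show ?thesis .
  qed
  show ?thesis
    using *[of a b] *[of b a] assms by (cases "a \<le> b") (auto simp: abs_if)
qed

lemma jointly_holder_exp:
  fixes f :: "real ^ 'm \<Rightarrow> real ^ 'n \<Rightarrow> real"
  assumes holder: "jointly_holder A \<beta> B \<gamma> f"
    and le: "\<And>x z. x \<in> unit_cube \<Longrightarrow> z \<in> unit_cube \<Longrightarrow> f x z \<le> N"
  shows "jointly_holder (exp N * A) \<beta> (exp N * B) \<gamma> (\<lambda>x z. exp (f x z))"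
  unfolding jointly_holder_def
proof (intro ballI)
  fix x x' :: "real ^ 'm" and z z' :: "real ^ 'n"
  assume mem: "x \<in> unit_cube" "x' \<in> unit_cube" "z \<in> unit_cube" "z' \<in> unit_cube"
  have "\<bar>exp (f x z) - exp (f x' z')\<bar> \<le> exp N * \<bar>f x z - f x' z'\<bar>"
    using mem by (intro abs_exp_diff_le le)
  also have "\<dots> \<le> exp N * (A * l1_norm (x - x') powr \<beta> + B * l1_norm (z - z') powr \<gamma>)"
    using mem by (intro mult_left_mono jointly_holderD[OF holder]) auto
  finally show "\<bar>exp (f x z) - exp (f x' z')\<bar>
      \<le> exp N * A * l1_norm (x - x') powr \<beta> + exp N * B * l1_norm (z - z') powr \<gamma>"
    by (simp add: algebra_simps)
qed

section \<open>Normalisation\<close>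

lemma set_integral_const_unit_cube:
  "(LINT x:(unit_cube :: (real ^ 'm) set)|lborel. c) = (c :: real)"
  "set_integrable lborel (unit_cube :: (real ^ 'm) set) (\<lambda>x. c)"
proof -
  have "0 \<in> (unit_cube :: (real ^ 'm) set)"
    by (simp add: mem_box_cart)
  then have "measure lborel (unit_cube :: (real ^ 'm) set) = 1"
    by (subst content_cbox_cart) auto
  then show "(LINT x:(unit_cube :: (real ^ 'm) set)|lborel. c) = c"
    by (simp add: set_lebesgue_integral_def)
  show "set_integrable lborel (unit_cube :: (real ^ 'm) set) (\<lambda>x. c)"
    unfolding set_integrable_def by (intro borel_integrable_compact) auto
qed

lemma set_integrable_continuous_unit_cube:
  fixes f :: "real ^ 'm \<Rightarrow> real"
  assumes "continuous_on unit_cube f"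
  shows "set_integrable lborel unit_cube f"
  unfolding set_integrable_def by (rule borel_integrable_compact[OF compact_cbox assms])

definition log_partition :: "(real ^ 'm \<Rightarrow> real ^ 'n \<Rightarrow> real) \<Rightarrow> real ^ 'n \<Rightarrow> real" where
  "log_partition f z = ln (LINT y:unit_cube|lborel. exp (f y z))"

lemma partition_ge:
  fixes f :: "real ^ 'm \<Rightarrow> real ^ 'n \<Rightarrow> real"
  assumes cont: "continuous_on unit_cube (\<lambda>y. f y z)"
    and ge: "\<And>y. y \<in> unit_cube \<Longrightarrow> -M \<le> f y z"
  shows "exp (-M) \<le> (LINT y:unit_cube|lborel. exp (f y z))"
proof -
  have "(LINT y:(unit_cube :: (real ^ 'm) set)|lborel. exp (-M))
      \<le> (LINT y:unit_cube|lborel. exp (f y z))"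
    using ge by (intro set_integral_mono set_integral_const_unit_cube
        set_integrable_continuous_unit_cube continuous_on_exp cont) auto
  then show ?thesis
    by (simp add: set_integral_const_unit_cube)
qed

text \<open>
  A bound on \<open>f\<close> that is uniform in \<open>y\<close> turns into a multiplicative bound on the integrands, which
  survives integration and becomes additive again under the logarithm. The constant is therefore
  preserved.
\<close>

lemma log_partition_diff_le:
  fixes f :: "real ^ 'm \<Rightarrow> real ^ 'n \<Rightarrow> real"
  assumes cont: "\<And>z. z \<in> unit_cube \<Longrightarrow> continuous_on unit_cube (\<lambda>y. f y z)"
    and ge: "\<And>y z. y \<in> unit_cube \<Longrightarrow> z \<in> unit_cube \<Longrightarrow> -M \<le> f y z"
    and le: "\<And>y. y \<in> unit_cube \<Longrightarrow> f y z - f y z' \<le> r"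
    and mem: "z \<in> unit_cube" "z' \<in> unit_cube"
  shows "log_partition f z - log_partition f z' \<le> r"
proof -
  let ?Z = "\<lambda>z. LINT y:unit_cube|lborel. exp (f y z)"
  have pos: "0 < ?Z z" if "z \<in> unit_cube" for z
    by (rule less_le_trans[OF exp_gt_zero partition_ge[of f z M]]) (use that cont ge in auto)
  have int: "set_integrable lborel unit_cube (\<lambda>y. exp (f y z))" if "z \<in> unit_cube" for z
    using that by (intro set_integrable_continuous_unit_cube continuous_on_exp cont)
  have "?Z z \<le> (LINT y:unit_cube|lborel. exp r * exp (f y z'))"
  proof (rule set_integral_mono)
    fix y :: "real ^ 'm" assume "y \<in> unit_cube"
    from le[OF this] show "exp (f y z) \<le> exp r * exp (f y z')"
      by (simp flip: exp_add)
  qed (use int mem in auto)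
  then have "?Z z \<le> exp r * ?Z z'"
    by simp
  then have "ln (?Z z) \<le> ln (exp r * ?Z z')"
    using pos mem by (subst ln_le_cancel_iff) auto
  then show ?thesis
    using pos[OF mem(2)] by (simp add: log_partition_def ln_mult)
qed

lemma jointly_holder_log_density:
  fixes f :: "real ^ 'm \<Rightarrow> real ^ 'n \<Rightarrow> real"
  assumes holder: "jointly_holder A \<beta> B \<gamma> f" and exps: "0 < \<beta>" "0 < \<gamma>"
    and ge: "\<And>x z. x \<in> unit_cube \<Longrightarrow> z \<in> unit_cube \<Longrightarrow> -M \<le> f x z"
  shows "jointly_holder A \<beta> (2 * B) \<gamma> (\<lambda>x z. f x z - log_partition f z)"
  unfolding jointly_holder_def
proof (intro ballI)
  fix x x' :: "real ^ 'm" and z z' :: "real ^ 'n"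
  assume mem: "x \<in> unit_cube" "x' \<in> unit_cube" "z \<in> unit_cube" "z' \<in> unit_cube"
  have "log_partition f z - log_partition f z' \<le> B * l1_norm (z - z') powr \<gamma>"
    if "z \<in> unit_cube" "z' \<in> unit_cube" for z z' :: "real ^ 'n"
  proof (rule log_partition_diff_le[where M = M])
    fix y :: "real ^ 'm" assume "y \<in> unit_cube"
    from jointly_holderD[OF holder this this that] exps
    show "f y z - f y z' \<le> B * l1_norm (z - z') powr \<gamma>" by simp
  qed (use that ge continuous_on_section_jointly_holder[OF holder exps] in auto)
  from this[OF mem(3,4)] this[OF mem(4,3)]
  have "\<bar>log_partition f z - log_partition f z'\<bar> \<le> B * l1_norm (z - z') powr \<gamma>"
    by (simp add: l1_norm_def abs_minus_commute abs_le_iff)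
  then show "\<bar>f x z - log_partition f z - (f x' z' - log_partition f z')\<bar>
      \<le> A * l1_norm (x - x') powr \<beta> + 2 * B * l1_norm (z - z') powr \<gamma>"
    using jointly_holderD[OF holder mem] by linarith
qed

section \<open>Joint densities\<close>

text \<open>
  Integrating in \<open>x\<close> first leaves the marginal density, since each conditional density has mass one.
  By Tonelli's theorem this gives integrability of the product and its total mass at once.
\<close>

lemma factorization_of_conditional:
  fixes q :: "real ^ 'm \<Rightarrow> real ^ 'n \<Rightarrow> real"
  assumes meas: "(\<lambda>(x, z). indicator (unit_cube \<times> unit_cube) (x, z) * q x z) \<in> borel_measurable borel"
    and cond: "\<And>z. z \<in> unit_cube \<Longrightarrow> prob_density_on unit_cube (\<lambda>x. q x z)"
    and marg: "prob_density_on unit_cube pZ"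
    and p: "\<And>x z. x \<in> unit_cube \<Longrightarrow> z \<in> unit_cube \<Longrightarrow> p (x, z) = q x z * pZ z"
  shows "factorization p q pZ"
proof -
  define q0 where "q0 x z = indicator unit_cube x * q x z" for x z
  define r where "r z = indicator unit_cube z * pZ z" for z
  define F where "F w = indicator (unit_cube \<times> unit_cube) w *\<^sub>R p w" for w
  have F_eq: "F (x, z) = q0 x z * r z" for x z
    using p by (auto simp: F_def q0_def r_def indicator_def)
  have r_int: "integrable lborel r" and r_one: "integral\<^sup>L lborel r = 1"
    using marg
    by (simp_all add: r_def[abs_def] prob_density_on_def set_integrable_def set_lebesgue_integral_def)
  have r_nonneg: "0 \<le> r z" for z
    using marg by (auto simp: r_def prob_density_on_def indicator_def)
  have q0_nonneg: "0 \<le> q0 x z" if "z \<in> unit_cube" for x z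
    using cond[OF that] by (auto simp: q0_def prob_density_on_def indicator_def)
  have F_nonneg: "0 \<le> F w" for w
  proof (cases w)
    case (Pair x z)
    show ?thesis
    proof (cases "z \<in> unit_cube")
      case True
      then show ?thesis using q0_nonneg r_nonneg by (simp add: Pair F_eq)
    qed (simp add: Pair F_eq r_def)
  qed
  have F_meas: "F \<in> borel_measurable (lborel \<Otimes>\<^sub>M lborel)"
  proof -
    have "(\<lambda>(x, z). indicator (unit_cube \<times> unit_cube) (x, z) * q x z)
        \<in> borel_measurable (lborel \<Otimes>\<^sub>M lborel)"
      using meas by (simp add: lborel_prod)
    moreover have "(\<lambda>w. r (snd w)) \<in> borel_measurable (lborel \<Otimes>\<^sub>M lborel)"
      using borel_measurable_integrable[OF r_int] by (rule measurable_compose[OF measurable_snd])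
    ultimately have "(\<lambda>w. (\<lambda>(x, z). indicator (unit_cube \<times> unit_cube) (x, z) * q x z) w * r (snd w))
        \<in> borel_measurable (lborel \<Otimes>\<^sub>M lborel)"
      by (rule borel_measurable_times)
    also have "(\<lambda>w. (\<lambda>(x, z). indicator (unit_cube \<times> unit_cube) (x, z) * q x z) w * r (snd w)) = F"
      by (auto simp: fun_eq_iff F_eq q0_def r_def indicator_def)
    finally show ?thesis .
  qed
  have inner: "(\<integral>\<^sup>+ x. ennreal (F (x, z)) \<partial>lborel) = ennreal (r z)" for z
  proof (cases "z \<in> unit_cube")
    case True
    then have "integrable lborel (\<lambda>x. q0 x z)" "(LINT x|lborel. q0 x z) = 1"
      using cond[OF True]
      by (auto simp: q0_def prob_density_on_def set_integrable_def set_lebesgue_integral_def)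
    then show ?thesis
      using True q0_nonneg r_nonneg unfolding F_eq by (subst nn_integral_eq_integral) auto
  qed (simp add: F_eq r_def)
  have "(\<integral>\<^sup>+ w. ennreal (F w) \<partial>(lborel \<Otimes>\<^sub>M lborel)) = (\<integral>\<^sup>+ z. ennreal (r z) \<partial>lborel)"
    using F_meas by (subst lborel_pair.nn_integral_snd[symmetric]) (simp_all add: inner)
  also have "\<dots> = ennreal 1"
    using r_int r_one r_nonneg by (subst nn_integral_eq_integral) auto
  finally have "has_bochner_integral (lborel \<Otimes>\<^sub>M lborel) F 1"
    using F_meas F_nonneg by (intro has_bochner_integral_nn_integral) auto
  then have "has_bochner_integral lborel F 1"
    by (simp add: lborel_prod)
  moreover have "0 \<le> p w" if "w \<in> unit_cube \<times> unit_cube" for w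
    using F_nonneg[of w] that by (simp add: F_def)
  ultimately have "prob_density_on (unit_cube \<times> unit_cube) p"
    unfolding prob_density_on_def set_integrable_def set_lebesgue_integral_def F_def
    by (auto simp: has_bochner_integral_iff)
  then show ?thesis
    using cond marg p by (simp add: factorization_def)
qed

section \<open>Smoothness of conditional densities\<close>

lemma strict_floor_eq_zero: "0 < \<beta> \<Longrightarrow> \<beta> \<le> 1 \<Longrightarrow> strict_floor \<beta> = 0"
  unfolding strict_floor_def by (simp add: ceiling_le_iff)

text \<open>The only list without occurrences of any index is empty.\<close>

lemma multi_deriv_zero:
  assumes "(\<Sum>i\<in>UNIV. \<alpha> $ i) = 0"
  shows "multi_deriv S \<alpha> f = f"
proof -
  have "(\<lambda>is. \<forall>i. count_list is i = \<alpha> $ i) = (\<lambda>is. is = [])"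
    using assms by (auto simp: fun_eq_iff count_list_0_iff intro: set_empty[THEN iffD1])
  then show ?thesis
    by (simp add: multi_deriv_def)
qed

lemma smooth_conditional_of_jointly_holder:
  fixes q :: "real ^ 'm \<Rightarrow> real ^ 'n \<Rightarrow> real"
  assumes holder: "jointly_holder A \<beta> B \<gamma> q"
    and exps: "0 < \<beta>" "\<beta> \<le> 1" "0 < \<gamma>"
  shows "smooth_conditional \<beta> \<gamma> q"
proof -
  \<comment> \<open>A Hoelder constant may be zero or negative, but the class asks for positive ones.\<close>
  have weaken: "c * t powr s \<le> (\<bar>c\<bar> + 1) * t powr s" for c t s :: real
    by (intro mult_right_mono) auto
  have "holder_smooth \<beta> (\<bar>A\<bar> + 1) q"
    unfolding holder_smooth_def strict_floor_eq_zero[OF exps(1,2)]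
  proof (intro ballI conjI allI impI)
    fix z :: "real ^ 'n" and \<alpha> :: "nat ^ 'm" and x x' :: "real ^ 'm"
    assume mem: "z \<in> unit_cube" "x \<in> unit_cube" "x' \<in> unit_cube" and "(\<Sum>i\<in>UNIV. \<alpha> $ i) = 0"
    then show "\<bar>multi_deriv unit_cube \<alpha> (\<lambda>x. q x z) x - multi_deriv unit_cube \<alpha> (\<lambda>x. q x z) x'\<bar>
        \<le> (\<bar>A\<bar> + 1) * l1_norm (x - x') powr (\<beta> - real 0)"
      using jointly_holderD[OF holder mem(2,3,1,1)] weaken[of A "l1_norm (x - x')" \<beta>] exps
      by (simp add: multi_deriv_zero)
  qed simp
  moreover have "tv_smooth \<gamma> (\<bar>B\<bar> + 1) q"
    unfolding tv_smooth_def
  proof (intro ballI)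
    fix z z' :: "real ^ 'n" assume mem: "z \<in> unit_cube" "z' \<in> unit_cube"
    let ?c = "(\<bar>B\<bar> + 1) * l1_norm (z - z') powr \<gamma>"
    have "(LINT x:unit_cube|lborel. \<bar>q x z - q x z'\<bar>)
        \<le> (LINT x:(unit_cube :: (real ^ 'm) set)|lborel. ?c)"
    proof (rule set_integral_mono)
      fix x :: "real ^ 'm" assume "x \<in> unit_cube"
      from jointly_holderD[OF holder this this mem] weaken[of B "l1_norm (z - z')" \<gamma>]
      show "\<bar>q x z - q x z'\<bar> \<le> ?c"
        using exps by simp
    qed (intro set_integrable_continuous_unit_cube set_integral_const_unit_cube continuous_intros
        continuous_on_section_jointly_holder[OF holder exps(1,3)] mem)+
    then show "(LINT x:unit_cube|lborel. \<bar>q x z - q x z'\<bar>) \<le> ?c"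
      by (simp add: set_integral_const_unit_cube)
  qed
  ultimately show ?thesis
    unfolding smooth_conditional_def
    by (meson abs_ge_zero add_nonneg_pos zero_less_one)
qed

lemma jointly_holder_cong:
  assumes "\<And>x z. x \<in> unit_cube \<Longrightarrow> z \<in> unit_cube \<Longrightarrow> f x z = f' x z"
  shows "jointly_holder A \<beta> B \<gamma> f \<longleftrightarrow> jointly_holder A \<beta> B \<gamma> f'"
  using assms unfolding jointly_holder_def by auto

theorem theorem5p2:
  fixes g :: "(real ^ 'm) \<times> (real ^ 'n) \<Rightarrow> real"
    and p_XgZ :: "real ^ 'm \<Rightarrow> real ^ 'n \<Rightarrow> real"
    and p_Z :: "real ^ 'n \<Rightarrow> real"
    and p_XZ :: "(real ^ 'm) \<times> (real ^ 'n) \<Rightarrow> real"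
    and \<beta> \<gamma> M C :: real
  assumes "0 < \<beta>" "\<beta> \<le> 1" "0 < \<gamma>" "\<gamma> \<le> 1"
    and "\<And>x z. x \<in> unit_cube \<Longrightarrow> z \<in> unit_cube \<Longrightarrow> g (x, z) \<in> {-M..M}"
    and "\<And>x z x' z'. x \<in> unit_cube \<Longrightarrow> z \<in> unit_cube \<Longrightarrow> x' \<in> unit_cube \<Longrightarrow> z' \<in> unit_cube \<Longrightarrow>
           \<bar>g (x, z) - g (x', z')\<bar> \<le> C * (l1_norm (x - x') powr \<beta> + l1_norm (z - z') powr \<gamma>)"
    and "\<And>x z. x \<in> unit_cube \<Longrightarrow> z \<in> unit_cube \<Longrightarrow>
           p_XgZ x z = exp (g (x, z)) / (LINT y:unit_cube|lborel. exp (g (y, z)))"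
    and "prob_density_on unit_cube p_Z"
    and "\<And>x z. x \<in> unit_cube \<Longrightarrow> z \<in> unit_cube \<Longrightarrow> p_XZ (x, z) = p_XgZ x z * p_Z z"
  shows "p_XZ \<in> density_class \<beta> \<gamma> \<and>
         factorization p_XZ p_XgZ p_Z \<and> smooth_conditional \<beta> \<gamma> p_XgZ"
proof -
  define f where "f x z = g (x, z)" for x z
  define Z where "Z z = (LINT y:unit_cube|lborel. exp (f y z))" for z
  have f_bounds: "-M \<le> f x z" "f x z \<le> M" if "x \<in> unit_cube" "z \<in> unit_cube" for x z
    using assms(5)[OF that] by (auto simp: f_def)
  have f_holder: "jointly_holder C \<beta> C \<gamma> f"
    unfolding jointly_holder_def f_def using assms(6) by (simp flip: distrib_left)
  note f_cont = continuous_on_section_jointly_holder[OF f_holder assms(1,3)]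
  have Z_ge: "exp (-M) \<le> Z z" if "z \<in> unit_cube" for z
    unfolding Z_def using that f_cont f_bounds by (intro partition_ge) auto
  have Z_pos: "0 < Z z" if "z \<in> unit_cube" for z
    using Z_ge[OF that] by (rule less_le_trans[OF exp_gt_zero])
  have q_eq: "p_XgZ x z = exp (f x z) / Z z" if "x \<in> unit_cube" "z \<in> unit_cube" for x z
    using assms(7)[OF that] by (simp add: f_def Z_def)
  have log_density_le: "f x z - log_partition f z \<le> 2 * M"
    if "x \<in> unit_cube" "z \<in> unit_cube" for x z
  proof -
    have "-M \<le> log_partition f z"
      unfolding log_partition_def Z_def[symmetric]
      using Z_ge[OF that(2)] Z_pos[OF that(2)] by (simp add: ln_ge_iff)
    then show ?thesis
      using f_bounds[OF that] by simp
  qed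
  have q_log: "p_XgZ x z = exp (f x z - log_partition f z)"
    if "x \<in> unit_cube" "z \<in> unit_cube" for x z
    using that Z_pos by (simp add: q_eq exp_diff log_partition_def flip: Z_def)
  have "jointly_holder (exp (2 * M) * C) \<beta> (exp (2 * M) * (2 * C)) \<gamma>
      (\<lambda>x z. exp (f x z - log_partition f z))"
    by (rule jointly_holder_exp[OF jointly_holder_log_density[OF f_holder assms(1,3) f_bounds(1)]
          log_density_le])
  then have q_holder: "jointly_holder (exp (2 * M) * C) \<beta> (exp (2 * M) * (2 * C)) \<gamma> p_XgZ"
    using jointly_holder_cong[of p_XgZ, OF q_log] by blast
  have cond: "prob_density_on unit_cube (\<lambda>x. p_XgZ x z)" if "z \<in> unit_cube" for z
  proof -
    have "(LINT x:unit_cube|lborel. p_XgZ x z) = (LINT x:unit_cube|lborel. exp (f x z) / Z z)"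
      using that by (intro set_lebesgue_integral_cong) (auto simp: q_eq)
    also have "\<dots> = 1"
      using Z_pos[OF that] by (simp flip: Z_def)
    finally show ?thesis
      using that q_log continuous_on_section_jointly_holder[OF q_holder assms(1,3) that]
      by (auto simp: prob_density_on_def intro: set_integrable_continuous_unit_cube)
  qed
  have "(\<lambda>w. indicator (unit_cube \<times> unit_cube) w *\<^sub>R (\<lambda>(x, z). p_XgZ x z) w)
      \<in> borel_measurable borel"
    by (intro borel_measurable_continuous_on_indicator
        continuous_on_jointly_holder[OF q_holder assms(1,3)] borel_closed closed_Times closed_cbox)
  then have "(\<lambda>(x, z). indicator (unit_cube \<times> unit_cube) (x, z) * p_XgZ x z)
      \<in> borel_measurable borel"
    by (simp add: case_prod_unfold)
  then have fac: "factorization p_XZ p_XgZ p_Z"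
    using cond assms(8,9) by (rule factorization_of_conditional)
  moreover have smooth: "smooth_conditional \<beta> \<gamma> p_XgZ"
    by (rule smooth_conditional_of_jointly_holder[OF q_holder assms(1-3)])
  ultimately show ?thesis
    unfolding density_class_def by blast
qed

end
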